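(* Let $r \geqslant 1$ and $n \geqslant r+1$, and let $A$ be an $r \times n$ integer matrix each of whose rows sums to zero. Then \[ \frac{(-1)^{n+r}}{12} \sum_{\substack{\mathcal{I} \vdash [n] \\ \ell(\mathcal{I})=r+1}} (\# I_1-1)! \cdots (\# I_{r+1}-1)! \cdot G_{r \times r}(A_{\mathcal{I}})^2 \;=\; \frac{(-1)^{n+r}}{12} \, \frac{(n-1)!}{(r+1)!} \sum_{\substack{I \subseteq [n] \\ \# I = r}} M_I(A)^2, \] where the sum on the left is over partitions $\mathcal{I}=\{I_1,\ldots,I_{r+1}\}$ of the set $[n]$ into exactly $r+1$ parts, and $M_I(A)$ denotes the $r \times r$ minor of $A$ given by the columns indexed by $I$.
   Context: $[n]=\{1,\ldots,n\}$. A partition $\mathcal{I} \vdash [n]$ is an unordered collection $\{I_1,\ldots,I_{\ell(\mathcal{I})}\}$ of nonempty pairwise disjoint subsets with union $[n]$; $\ell(\mathcal{I})$ is its number of parts. For $A=(a^{(j)}_i)$, the contraction $A_{\mathcal{I}}$ is the $r \times \ell(\mathcal{I})$ matrix with entries $a^{(j)}_{I_s} = \sum_{i \in I_s} a^{(j)}_i$, i.e. obtained by summing the columns of $A$ indexed by each part; it is well-defined up to permuting columns. $G_{r \times r}(A_{\mathcal{I}})$ is the greatest common divisor (well-defined up to sign) of all the $r \times r$ minors of $A_{\mathcal{I}}$, with the convention that zeros are ignored in a gcd and the gcd of a collection of zeros is $0$. *)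

theory Defs
  imports Complex_Main "HOL-Library.Disjoint_Sets" "Jordan_Normal_Form.DL_Submatrix"
    "Jordan_Normal_Form.Determinant"
begin

(* Matrices are indexed from 0, so [n] becomes {..<n} throughout. *)

(* The minor M_J(A) given by the columns in J; an r x r minor when A has r rows and
   J is an r-element subset of its column indices. *)
definition column_minor :: "'a :: comm_ring_1 mat \<Rightarrow> nat set \<Rightarrow> 'a" where
  "column_minor A J = det (submatrix A UNIV J)"

(* Gcd over int is nonnegative and agrees with the convention that zeros are ignored:
   Gcd {0} = 0, and Gcd (insert 0 S) = Gcd S. *)
definition gcd_minors :: "nat \<Rightarrow> int mat \<Rightarrow> int" where
  "gcd_minors k M = Gcd {det (submatrix M I J) | I J.
     I \<subseteq> {..<dim_row M} \<and> card I = k \<and> J \<subseteq> {..<dim_col M} \<and> card J = k}"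

(* The parts of a partition in a fixed order, by their least elements. Contractions are only
   defined up to permuting columns; this picks one representative. *)
definition parts_list :: "nat set set \<Rightarrow> nat set list" where
  "parts_list P = sorted_key_list_of_set Min P"

definition contraction :: "'a :: comm_monoid_add mat \<Rightarrow> nat set set \<Rightarrow> 'a mat" where
  "contraction A P = mat (dim_row A) (card P) (\<lambda>(i, s). \<Sum>j\<in>parts_list P ! s. A $$ (i, j))"

lemma (in linorder) sorted_key_list_of_set_enumerates:
  assumes "inj_on f S" "finite S"
  shows "set (sorted_key_list_of_set f S) = S" "distinct (sorted_key_list_of_set f S)"
    "length (sorted_key_list_of_set f S) = card S"
proof -
  interpret folding_insort_key "(\<le>)" "(<)" S f
    using assms(1) by unfold_locales
  show "set (sorted_key_list_of_set f S) = S" "length (sorted_key_list_of_set f S) = card S"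
    using assms(2) by simp_all
  show "distinct (sorted_key_list_of_set f S)"
    by (rule distinct_if_distinct_map) (rule distinct_sorted_key_list_of_set, simp)
qed

lemma parts_list:
  assumes "partition_on {..<n} P"
  shows "set (parts_list P) = P" "distinct (parts_list P)" "length (parts_list P) = card P"
proof -
  have fin: "finite P"
    using assms finite_elements by blast
  have Min_in: "Min I \<in> I" if "I \<in> P" for I
  proof -
    have "I \<subseteq> {..<n}"
      using assms that by (auto simp: partition_on_def)
    then have "finite I"
      by (rule finite_subset) simp
    moreover have "I \<noteq> {}"
      using assms that by (auto simp: partition_on_def)
    ultimately show ?thesis
      by simp
  qed
  have inj: "inj_on Min P"
  proof (rule inj_onI)
    fix I J assume "I \<in> P" "J \<in> P" "Min I = Min J"
    then show "I = J"
      using Min_in[of I] Min_in[of J] assms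
      by (auto simp: partition_on_def disjoint_def)
  qed
  show "set (parts_list P) = P" "distinct (parts_list P)" "length (parts_list P) = card P"
    using sorted_key_list_of_set_enumerates[OF inj fin] by (simp_all add: parts_list_def)
qed

end

theory Submission
  imports Defs "HOL-Library.Function_Algebras"
begin

text \<open>
  Write \<open>f\<close> for the determinant of \<open>r\<close> columns, as an alternating multilinear form, and let
  \<open>T r f X b\<close> be the sum of \<open>(f (b x\<^sub>1, \<dots>, b x\<^sub>r))\<^sup>2\<close> over all \<open>r\<close>-tuples from \<open>X\<close>. Tuples with
  a repetition contribute nothing, so \<open>T\<close> is \<open>r!\<close> times the sum of the squared minors. Since
  the columns of a contraction sum to zero, its \<open>r + 1\<close> maximal minors agree up to sign, and
  \<open>T\<close> of the contraction is \<open>(r + 1)! G\<^sup>2\<close>.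

  The identity relating \<open>T\<close> of all contractions to \<open>T\<close> of the columns \<open>a\<^sub>j\<close> holds for every
  alternating form \<open>f\<close> that vanishes when one argument is the sum of all columns, and it is
  proved for all \<open>r\<close> and \<open>f\<close> by induction on the number of columns. When a column \<open>v\<close> is added, it
  forms a part of its own, which leads to the form \<open>f(v, \<dots>)\<close> in \<open>r - 1\<close> arguments, or it joins an existing
  part \<open>I\<close>. The weight then grows by the factor \<open>#I\<close>, which is a choice of some \<open>j\<close> in \<open>I\<close>
  whose column is replaced by \<open>a\<^sub>j + v\<close>.
\<close>

section \<open>Alternating forms on lists of vectors\<close>

text \<open>Additivity in each argument is multilinearity over the integers. Vanishing is demanded
  only for equal neighbours; \<open>alternating_swap\<close> and
  \<open>alternating_not_distinct\<close> deduce the rest. Lists of length other than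
  \<open>r\<close> are unconstrained.\<close>

definition alternating :: "nat \<Rightarrow> ('v::ab_group_add list \<Rightarrow> 'b::comm_ring_1) \<Rightarrow> bool" where
  "alternating r f \<longleftrightarrow>
     (\<forall>xs ys x y. Suc (length xs + length ys) = r \<longrightarrow>
        f (xs @ (x + y) # ys) = f (xs @ x # ys) + f (xs @ y # ys)) \<and>
     (\<forall>xs ys x. Suc (Suc (length xs + length ys)) = r \<longrightarrow> f (xs @ x # x # ys) = 0)"

lemma alternating_add:
  assumes "alternating r f" "Suc (length xs + length ys) = r"
  shows "f (xs @ (x + y) # ys) = f (xs @ x # ys) + f (xs @ y # ys)"
  using assms unfolding alternating_def by blast

lemma alternating_repeat:
  assumes "alternating r f" "Suc (Suc (length xs + length ys)) = r"
  shows "f (xs @ x # x # ys) = 0"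
  using assms unfolding alternating_def by blast

lemma alternating_Cons:
  fixes f :: "'v::ab_group_add list \<Rightarrow> 'b::comm_ring_1"
  assumes "alternating (Suc r) f"
  shows "alternating r (\<lambda>xs. f (v # xs))"
  unfolding alternating_def
proof (intro conjI allI impI)
  fix xs ys :: "'v list" and x y assume "Suc (length xs + length ys) = r"
  then show "f (v # xs @ (x + y) # ys) = f (v # xs @ x # ys) + f (v # xs @ y # ys)"
    using alternating_add[OF assms, of "v # xs" ys x y] by simp
next
  fix xs ys :: "'v list" and x assume "Suc (Suc (length xs + length ys)) = r"
  then show "f (v # xs @ x # x # ys) = 0"
    using alternating_repeat[OF assms, of "v # xs" ys x] by simp
qed

text \<open>Polarization: the form vanishes when both neighbours are \<open>x + y\<close>, and
  expanding leaves the two mixed terms.\<close>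

lemma alternating_swap:
  assumes f: "alternating r f" and len: "Suc (Suc (length xs + length ys)) = r"
  shows "f (xs @ x # y # ys) = - f (xs @ y # x # ys)"
proof -
  have "f (xs @ (x + y) # (x + y) # ys)
      = f (xs @ x # (x + y) # ys) + f (xs @ y # (x + y) # ys)"
    using alternating_add[OF f, of xs "(x + y) # ys"] len by simp
  also have "f (xs @ x # (x + y) # ys) = f (xs @ x # x # ys) + f (xs @ x # y # ys)"
    using alternating_add[OF f, of "xs @ [x]" ys] len by simp
  also have "f (xs @ y # (x + y) # ys) = f (xs @ y # x # ys) + f (xs @ y # y # ys)"
    using alternating_add[OF f, of "xs @ [y]" ys] len by simp
  finally have "f (xs @ x # y # ys) + f (xs @ y # x # ys) = 0"
    using alternating_repeat[OF f len] by simp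
  then show ?thesis
    by (simp add: eq_neg_iff_add_eq_0)
qed

lemma alternating_move:
  assumes f: "alternating r f" and len: "Suc (length us + length vs + length ws) = r"
  shows "f (us @ vs @ y # ws) = (- 1) ^ length vs * f (us @ y # vs @ ws)"
  using len
proof (induction vs arbitrary: us)
  case Nil
  then show ?case by simp
next
  case (Cons v vs)
  have "f ((us @ [v]) @ vs @ y # ws) = (- 1) ^ length vs * f (us @ v # y # vs @ ws)"
    using Cons.IH[of "us @ [v]"] Cons.prems by simp
  then show ?case
    using alternating_swap[OF f, of us "vs @ ws" v y] Cons.prems by simp
qed

text \<open>At the cost of a sign, \<open>alternating_move\<close> carries the second copy of a
  repeated entry next to the first.\<close>

lemma alternating_not_distinct:
  assumes f: "alternating r f" and len: "length xs = r" and "\<not> distinct xs"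
  shows "f xs = 0"
proof -
  obtain us vs ws y where xs: "xs = us @ [y] @ vs @ [y] @ ws"
    using not_distinct_decomp[OF \<open>\<not> distinct xs\<close>] by blast
  then have "f xs = (- 1) ^ length vs * f (us @ y # y # vs @ ws)"
    using alternating_move[OF f, of "us @ [y]" vs ws y] len by simp
  also have "f (us @ y # y # vs @ ws) = 0"
    using xs len by (intro alternating_repeat[OF f]) simp
  finally show ?thesis by simp
qed

lemma alternating_map_not_distinct:
  assumes "alternating r f" "length xs = r" "\<not> distinct xs"
  shows "f (map a xs) = 0"
  using alternating_not_distinct[OF assms(1), of "map a xs"] assms(2,3)
  by (auto simp: distinct_map)

lemma alternating_sum:
  assumes f: "alternating (Suc r) f" and "finite X" "length zs = r"
  shows "f ((\<Sum>x\<in>X. b x) # zs) = (\<Sum>x\<in>X. f (b x # zs))"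
proof -
  have add: "f ((x + y) # zs) = f (x # zs) + f (y # zs)" for x y
    using alternating_add[OF f, of "[]" zs] assms by simp
  have "f (0 # zs) = 0"
    using add[of 0 0] by simp
  with \<open>finite X\<close> show ?thesis
    by (induction X rule: finite_induct) (simp_all add: add)
qed

section \<open>Sums over tuples of indices and sums of squares\<close>

abbreviation lists_of :: "nat \<Rightarrow> 'i set \<Rightarrow> 'i list set" where
  "lists_of r X \<equiv> {xs. set xs \<subseteq> X \<and> length xs = r}"

text \<open>A list corresponds to its entry at position \<open>p\<close> together with the list that
  remains when this entry is cut out. This permits summing over one entry while the others stay
  fixed, whatever its position.\<close>

lemma sum_lists_of_insert_at:
  assumes "p \<le> r"
  shows "(\<Sum>xs\<in>lists_of (Suc r) X. g (take p xs) (xs ! p) (drop (Suc p) xs))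
       = (\<Sum>zs\<in>lists_of r X. \<Sum>y\<in>X. g (take p zs) y (drop p zs))"
proof -
  have "(\<Sum>xs\<in>lists_of (Suc r) X. g (take p xs) (xs ! p) (drop (Suc p) xs))
      = (\<Sum>(zs, y)\<in>lists_of r X \<times> X. g (take p zs) y (drop p zs))"
  proof (rule sum.reindex_bij_witness[where i = "\<lambda>(zs, y). take p zs @ y # drop p zs"
        and j = "\<lambda>xs. (take p xs @ drop (Suc p) xs, xs ! p)"])
    fix xs assume xs: "xs \<in> lists_of (Suc r) X"
    then have "p < length xs" using assms by simp
    then show "(\<lambda>(zs, y). take p zs @ y # drop p zs) (take p xs @ drop (Suc p) xs, xs ! p) = xs"
      by (simp add: id_take_nth_drop[symmetric])
    show "(take p xs @ drop (Suc p) xs, xs ! p) \<in> lists_of r X \<times> X"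
      using xs \<open>p < length xs\<close> by (auto dest: in_set_takeD in_set_dropD)
    show "(\<lambda>(zs, y). g (take p zs) y (drop p zs)) (take p xs @ drop (Suc p) xs, xs ! p)
        = g (take p xs) (xs ! p) (drop (Suc p) xs)"
      using \<open>p < length xs\<close> by simp
  next
    fix q assume "q \<in> lists_of r X \<times> X"
    then obtain zs y where q: "q = (zs, y)" "set zs \<subseteq> X" "length zs = r" "y \<in> X"
      by auto
    let ?xs = "take p zs @ y # drop p zs"
    show "(take p ((\<lambda>(zs, y). take p zs @ y # drop p zs) q)
          @ drop (Suc p) ((\<lambda>(zs, y). take p zs @ y # drop p zs) q),
          (\<lambda>(zs, y). take p zs @ y # drop p zs) q ! p) = q"
      using q assms by (simp add: nth_append)
    show "(\<lambda>(zs, y). take p zs @ y # drop p zs) q \<in> lists_of (Suc r) X"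
      using q assms by (auto dest: in_set_takeD in_set_dropD)
  qed
  then show ?thesis
    by (simp add: sum.cartesian_product)
qed

text \<open>The index set \<open>X\<close> may have any type: below it is a set of columns or a set
  of parts. Summing over all lists makes the recursion in \<open>r\<close> a plain split at the
  first entry.\<close>

definition square_sum ::
  "nat \<Rightarrow> ('v list \<Rightarrow> 'b::comm_ring_1) \<Rightarrow> 'i set \<Rightarrow> ('i \<Rightarrow> 'v) \<Rightarrow> 'b" where
  "square_sum r f X b = (\<Sum>xs\<in>lists_of r X. (f (map b xs))\<^sup>2)"

lemma square_sum_0 [simp]: "square_sum 0 f X b = (f [])\<^sup>2"
proof -
  have "lists_of 0 X = {[]}" by auto
  then show ?thesis by (simp add: square_sum_def)
qed

lemma square_sum_Suc:
  "square_sum (Suc r) f X b = (\<Sum>x\<in>X. square_sum r (\<lambda>xs. f (b x # xs)) X b)"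
proof -
  have "square_sum (Suc r) f X b
      = (\<Sum>xs\<in>lists_of (Suc r) X. (f (map b (take 0 xs @ xs ! 0 # drop (Suc 0) xs)))\<^sup>2)"
    unfolding square_sum_def by (rule sum.cong) (auto simp: length_Suc_conv)
  also have "\<dots> = (\<Sum>zs\<in>lists_of r X. \<Sum>y\<in>X. (f (map b (take 0 zs @ y # drop 0 zs)))\<^sup>2)"
    by (rule sum_lists_of_insert_at) simp
  also have "\<dots> = (\<Sum>x\<in>X. square_sum r (\<lambda>xs. f (b x # xs)) X b)"
    unfolding square_sum_def by (subst sum.swap) simp
  finally show ?thesis .
qed

text \<open>Comparing squares instead of values absorbs the sign of a swap of arguments.\<close>

lemma square_sum_cong:
  assumes "\<And>xs. set xs \<subseteq> X \<Longrightarrow> length xs = r \<Longrightarrow> (f (map b xs))\<^sup>2 = (g (map c xs))\<^sup>2"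
  shows "square_sum r f X b = square_sum r g X c"
  unfolding square_sum_def using assms by (intro sum.cong) auto

lemma square_sum_reindex:
  assumes "inj_on \<phi> X"
  shows "square_sum r f (\<phi> ` X) b = square_sum r f X (b \<circ> \<phi>)"
proof (induction r arbitrary: f)
  case 0
  then show ?case by simp
next
  case (Suc r)
  then show ?case
    by (simp add: square_sum_Suc sum.reindex[OF assms])
qed

text \<open>A tuple with nonzero value contains \<open>x\<close> at most once. If it does,
  \<open>x\<close> has one of \<open>Suc r\<close> positions, and moving it to the front changes
  only the sign, which the square forgets.\<close>

lemma square_sum_insert:
  fixes N :: "'i set" and f :: "'v::ab_group_add list \<Rightarrow> 'b::comm_ring_1"
  assumes "finite N" "x \<notin> N" "alternating (Suc r) f"
  shows "square_sum (Suc r) f (insert x N) a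
       = square_sum (Suc r) f N a + of_nat (Suc r) * square_sum r (\<lambda>xs. f (a x # xs)) N a"
  using assms(3)
proof (induction r arbitrary: f)
  case 0
  show ?case
    using assms(1,2) by (simp add: square_sum_Suc)
next
  case (Suc r)
  let ?T = "\<lambda>r f. square_sum r f N a"
  have alt: "alternating (Suc r) (\<lambda>xs. f (v # xs))" for v
    using alternating_Cons[OF Suc.prems] .
  have rep: "?T r (\<lambda>xs. f (a x # a x # xs)) = 0"
    unfolding square_sum_def
  proof (rule sum.neutral, rule ballI)
    fix xs assume "xs \<in> lists_of r N"
    then show "(f (a x # a x # map a xs))\<^sup>2 = 0"
      using alternating_repeat[OF Suc.prems, of "[]" "map a xs" "a x"] by simp
  qed
  have swap: "?T r (\<lambda>xs. f (a y # a x # xs)) = ?T r (\<lambda>xs. f (a x # a y # xs))" for y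
  proof (rule square_sum_cong)
    fix xs :: "'i list" assume "length xs = r"
    then show "(f (a y # a x # map a xs))\<^sup>2 = (f (a x # a y # map a xs))\<^sup>2"
      using alternating_swap[OF Suc.prems, of "[]" "map a xs" "a x" "a y"] by simp
  qed
  have "square_sum (Suc (Suc r)) f (insert x N) a
      = square_sum (Suc r) (\<lambda>xs. f (a x # xs)) (insert x N) a
        + (\<Sum>y\<in>N. square_sum (Suc r) (\<lambda>xs. f (a y # xs)) (insert x N) a)"
    by (subst square_sum_Suc) (use assms(1,2) in simp)
  \<comment> \<open>The induction hypothesis is applied to \<open>f (a x # _)\<close>, where its
    extra term contains \<open>a x\<close> twice and vanishes by \<open>rep\<close>, and to each
    \<open>f (a y # _)\<close>, where \<open>swap\<close> brings \<open>a x\<close> to the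
    front.\<close>
  also have "\<dots> = ?T (Suc r) (\<lambda>xs. f (a x # xs))
      + (\<Sum>y\<in>N. ?T (Suc r) (\<lambda>xs. f (a y # xs))
                + of_nat (Suc r) * ?T r (\<lambda>xs. f (a x # a y # xs)))"
    by (simp only: Suc.IH[OF alt] rep swap) simp
  also have "\<dots> = ?T (Suc (Suc r)) f + of_nat (Suc (Suc r)) * ?T (Suc r) (\<lambda>xs. f (a x # xs))"
    unfolding sum.distrib sum_distrib_left[symmetric]
    by (simp only: square_sum_Suc[of "Suc r" f] square_sum_Suc[of r "\<lambda>xs. f (a x # xs)"])
       (simp add: algebra_simps)
  finally show ?case .
qed

text \<open>A distinct tuple \<open>zs\<close> of length \<open>r\<close> omits exactly one index
  \<open>y0\<close> of \<open>X\<close>. Hence expanding \<open>f\<close> at the full sum over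
  \<open>X\<close> leaves the single term at \<open>y0\<close>, and \<open>kill\<close> identifies
  it with \<open>- f (v # map b zs)\<close>. In the applications \<open>v\<close> is the one vector
  missing from \<open>X\<close>.\<close>

lemma square_sum_drop_one:
  assumes "finite X" "card X = Suc r" and f: "alternating (Suc r) f"
    and kill: "\<And>xs. length xs = r \<Longrightarrow> f (((\<Sum>x\<in>X. b x) + v) # xs) = 0"
  shows "square_sum (Suc r) f X b = square_sum r (\<lambda>xs. f (v # xs)) X b"
proof -
  have eq: "(\<Sum>y\<in>X. (f (b y # map b zs))\<^sup>2) = (f (v # map b zs))\<^sup>2"
    if zs: "set zs \<subseteq> X" "length zs = r" for zs
  proof (cases "distinct zs")
    case False
    then have "f (b y # map b zs) = 0" for y
      using alternating_map_not_distinct[OF alternating_Cons[OF f]] zs by blast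
    moreover have "f (v # map b zs) = 0"
      using alternating_map_not_distinct[OF alternating_Cons[OF f]] zs False by blast
    ultimately show ?thesis by simp
  next
    case True
    then have "card (X - set zs) = 1"
      using zs assms(1,2) by (simp add: card_Diff_subset distinct_card)
    then obtain y0 where y0: "X - set zs = {y0}"
      using card_1_singletonE by blast
    have zero: "f (b y # map b zs) = 0" if "y \<in> X - {y0}" for y
      using alternating_map_not_distinct[OF f, of "y # zs" b] that y0 zs by auto
    have "f (((\<Sum>x\<in>X. b x) + v) # map b zs)
        = f ((\<Sum>x\<in>X. b x) # map b zs) + f (v # map b zs)"
      using alternating_add[OF f, of "[]" "map b zs"] zs by simp
    then have "f ((\<Sum>x\<in>X. b x) # map b zs) = - f (v # map b zs)"
      using kill[of "map b zs"] zs by (simp add: eq_neg_iff_add_eq_0)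
    moreover have "f ((\<Sum>x\<in>X. b x) # map b zs) = (\<Sum>y\<in>X. f (b y # map b zs))"
      using alternating_sum[OF f \<open>finite X\<close>] zs by simp
    moreover have "(\<Sum>y\<in>X. f (b y # map b zs)) = f (b y0 # map b zs)"
      using y0 zero by (subst sum.remove[OF \<open>finite X\<close>, of y0]) auto
    moreover have "(\<Sum>y\<in>X. (f (b y # map b zs))\<^sup>2) = (f (b y0 # map b zs))\<^sup>2"
      using y0 zero by (subst sum.remove[OF \<open>finite X\<close>, of y0]) auto
    ultimately show ?thesis by simp
  qed
  show ?thesis
    unfolding square_sum_Suc unfolding square_sum_def
    by (subst sum.swap) (rule sum.cong, use eq in auto)
qed

text \<open>
  Replacing \<open>a\<^sub>j\<close> by \<open>a\<^sub>j + v\<close> in one square gives, with \<open>zs\<close> the remaining \<open>k\<close> indices, a cross term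
  \<open>2 f(a\<^sub>j, zs) f(v, zs)\<close> and a square \<open>f(v, zs)\<^sup>2\<close>. Summed over \<open>j\<close> the cross terms collapse to
  \<open>- 2 f(v, zs)\<^sup>2\<close>, while the square occurs for the \<open>n - k\<close> indices \<open>j\<close> outside \<open>zs\<close>.
\<close>

lemma square_sum_shift:
  fixes a :: "'i \<Rightarrow> 'v::ab_group_add" and f :: "'v list \<Rightarrow> 'b::comm_ring_1"
  assumes fin: "finite N" and f: "alternating (Suc k) f"
    and kill: "\<And>xs. length xs = k \<Longrightarrow> f ((sum a N + v) # xs) = 0"
  shows "(\<Sum>j\<in>N. square_sum (Suc k) f N (a(j := a j + v)))
       = of_nat (card N) * square_sum (Suc k) f N a
         + (of_nat (card N) - of_nat k - 2) * of_nat (Suc k) * square_sum k (\<lambda>xs. f (v # xs)) N a"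
proof -
  define n :: 'b where "n = of_nat (card N)"
  \<comment> \<open>\<open>g us y ws\<close> is the change of the square at the tuple
    \<open>us @ y # ws\<close> when \<open>v\<close> is added to the column of \<open>y\<close>. The
    value 0 at a tuple with a repetition is correct, since there the form vanishes before and after
    the change.\<close>
  define g where "g us y ws = (if distinct (us @ y # ws) then
      2 * f (map a us @ a y # map a ws) * f (map a us @ v # map a ws)
      + (f (map a us @ v # map a ws))\<^sup>2 else 0)" for us y ws
  have expand: "(\<Sum>j\<in>N. (f (map (a(j := a j + v)) xs))\<^sup>2)
      = n * (f (map a xs))\<^sup>2 + (\<Sum>p\<le>k. g (take p xs) (xs ! p) (drop (Suc p) xs))"
    if xs: "set xs \<subseteq> N" "length xs = Suc k" for xs
  proof (cases "distinct xs")
    case False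
    then have "g (take p xs) (xs ! p) (drop (Suc p) xs) = 0" if "p \<le> k" for p
      using that xs by (simp add: g_def id_take_nth_drop[symmetric] del: distinct_append)
    then show ?thesis
      using alternating_map_not_distinct[OF f xs(2) False] by simp
  next
    case True
    define d where "d j = (f (map (a(j := a j + v)) xs))\<^sup>2 - (f (map a xs))\<^sup>2" for j
    have d: "d (xs ! p) = g (take p xs) (xs ! p) (drop (Suc p) xs)" if "p \<le> k" for p
    proof -
      define us y ws where "us = take p xs" and "y = xs ! p" and "ws = drop (Suc p) xs"
      have eq: "xs = us @ y # ws"
        unfolding us_def y_def ws_def using that xs by (simp add: id_take_nth_drop[symmetric])
      have y: "y \<notin> set us" "y \<notin> set ws" and dist: "distinct (us @ y # ws)"
        using True eq by auto
      have "map (a(y := a y + v)) xs = map a us @ (a y + v) # map a ws"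
        using y unfolding eq by simp
      then have "f (map (a(y := a y + v)) xs) = f (map a us @ (a y + v) # map a ws)"
        by (simp only:)
      also have "f (map a us @ (a y + v) # map a ws)
          = f (map a us @ a y # map a ws) + f (map a us @ v # map a ws)"
        using xs eq by (intro alternating_add[OF f]) simp
      finally have "d y = g us y ws"
        using dist by (simp add: d_def g_def eq power2_eq_square algebra_simps)
      then show ?thesis by (simp add: us_def y_def ws_def)
    qed
    \<comment> \<open>An index outside \<open>xs\<close> causes no change, so the sum over
      \<open>N\<close> becomes a sum over the positions of the distinct list
      \<open>xs\<close>.\<close>
    have "(\<Sum>j\<in>N. d j) = (\<Sum>j\<in>set xs. d j)"
    proof (rule sum.mono_neutral_right[OF fin xs(1)], rule ballI)
      fix j assume "j \<in> N - set xs"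
      then have "map (a(j := a j + v)) xs = map a xs" by auto
      then show "d j = 0" unfolding d_def by (simp only: diff_self)
    qed
    also have "\<dots> = (\<Sum>p<Suc k. d (xs ! p))"
      using sum.reindex_bij_betw[OF bij_betw_nth[OF True refl refl], of d] xs by simp
    also have "\<dots> = (\<Sum>p\<le>k. g (take p xs) (xs ! p) (drop (Suc p) xs))"
      unfolding lessThan_Suc_atMost by (rule sum.cong) (auto simp: d)
    finally show ?thesis
      by (simp add: d_def sum_subtractf n_def algebra_simps)
  qed
  have collapse: "(\<Sum>y\<in>N. g (take p zs) y (drop p zs)) = (n - of_nat k - 2) * (f (v # map a zs))\<^sup>2"
    if zs: "set zs \<subseteq> N" "length zs = k" and "p \<le> k" for zs p
  proof (cases "distinct zs")
    case False
    then have "\<not> distinct (take p zs @ y # drop p zs)" for y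
      by (metis append_take_drop_id distinct.simps(2) distinct_append disjoint_iff list.set_intros(2))
    then have "g (take p zs) y (drop p zs) = 0" for y
      by (simp add: g_def del: distinct_append)
    moreover have "f (v # map a zs) = 0"
      using alternating_map_not_distinct[OF alternating_Cons[OF f]] zs False by blast
    ultimately show ?thesis by simp
  next
    case True
    define us ws where "us = take p zs" and "ws = drop p zs"
    have eq: "zs = us @ ws" by (simp add: us_def ws_def)
    have len: "Suc (length us + length ws) = Suc k" using zs eq by simp
    \<comment> \<open>Moving the entry at position \<open>p\<close> to the front gives the same sign
      \<open>?s\<close> in both factors of each product, so the signs cancel.\<close>
    let ?s = "(- 1) ^ length us :: 'b"
    have move: "f (map a us @ x # map a ws) = ?s * f (x # map a zs)" for x
      using alternating_move[OF f, of "[]" "map a us" "map a ws" x] len eq by simp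
    have sign: "?s * y * (?s * z) = y * z" for y z
    proof -
      have "?s * y * (?s * z) = (?s * ?s) * (y * z)" by (simp only: ac_simps)
      also have "?s * ?s = 1" by (simp flip: power_add)
      finally show ?thesis by simp
    qed
    have prod: "f (map a us @ x # map a ws) * f (map a us @ v # map a ws)
        = f (x # map a zs) * f (v # map a zs)" for x
      unfolding move by (rule sign)
    \<comment> \<open>The cross term vanishes by itself when \<open>y\<close> occurs in
      \<open>zs\<close>, so it can be summed over all of \<open>N\<close>; the square needs an
      explicit indicator.\<close>
    have "g us y ws = 2 * f (a y # map a zs) * f (v # map a zs)
        + (if y \<in> N - set zs then (f (v # map a zs))\<^sup>2 else 0)" if "y \<in> N" for y
    proof (cases "y \<in> set zs")
      case True
      then have "f (a y # map a zs) = 0"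
        using alternating_map_not_distinct[OF f, of "y # zs" a] zs by simp
      then show ?thesis using True eq by (auto simp: g_def)
    next
      case False
      then have "distinct (us @ y # ws)" using \<open>distinct zs\<close> eq by auto
      then show ?thesis
        using False that by (simp add: g_def prod power2_eq_square mult.assoc)
    qed
    then have "(\<Sum>y\<in>N. g us y ws) = (\<Sum>y\<in>N. 2 * f (a y # map a zs) * f (v # map a zs))
        + (\<Sum>y\<in>N. if y \<in> N - set zs then (f (v # map a zs))\<^sup>2 else 0)"
      by (simp add: sum.distrib)
    also have "(\<Sum>y\<in>N. if y \<in> N - set zs then (f (v # map a zs))\<^sup>2 else 0)
        = of_nat (card (N - set zs)) * (f (v # map a zs))\<^sup>2"
      using sum.inter_restrict[OF fin, of "\<lambda>_. (f (v # map a zs))\<^sup>2" "N - set zs"]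
      by (simp add: Int_absorb1)
    also have "(\<Sum>y\<in>N. 2 * f (a y # map a zs) * f (v # map a zs))
        = 2 * f (sum a N # map a zs) * f (v # map a zs)"
      using alternating_sum[OF f fin, of "map a zs" a] zs
      by (simp add: sum_distrib_right[symmetric] sum_distrib_left[symmetric])
    also have "f (sum a N # map a zs) = - f (v # map a zs)"
      using alternating_add[OF f, of "[]" "map a zs" "sum a N" v] kill[of "map a zs"] zs
      by (simp add: eq_neg_iff_add_eq_0)
    also have "of_nat (card (N - set zs)) = n - of_nat k"
    proof -
      have "card (N - set zs) = card N - k" "k \<le> card N"
        using zs True card_mono[OF fin zs(1)]
        by (simp_all add: card_Diff_subset distinct_card)
      then show ?thesis by (simp add: n_def of_nat_diff)
    qed
    finally show ?thesis
      by (simp add: us_def ws_def power2_eq_square algebra_simps)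
  qed
  have "(\<Sum>j\<in>N. square_sum (Suc k) f N (a(j := a j + v)))
      = (\<Sum>xs\<in>lists_of (Suc k) N. \<Sum>j\<in>N. (f (map (a(j := a j + v)) xs))\<^sup>2)"
    unfolding square_sum_def by (rule sum.swap)
  also have "\<dots> = (\<Sum>xs\<in>lists_of (Suc k) N. n * (f (map a xs))\<^sup>2
      + (\<Sum>p\<le>k. g (take p xs) (xs ! p) (drop (Suc p) xs)))"
    by (rule sum.cong) (auto simp: expand)
  also have "\<dots> = n * square_sum (Suc k) f N a
      + (\<Sum>p\<le>k. \<Sum>xs\<in>lists_of (Suc k) N. g (take p xs) (xs ! p) (drop (Suc p) xs))"
    unfolding square_sum_def sum.distrib sum_distrib_left
    by (subst sum.swap) (rule refl)
  also have "(\<Sum>p\<le>k. \<Sum>xs\<in>lists_of (Suc k) N. g (take p xs) (xs ! p) (drop (Suc p) xs))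
      = (\<Sum>p\<le>k. (n - of_nat k - 2) * square_sum k (\<lambda>xs. f (v # xs)) N a)"
  proof (rule sum.cong)
    fix p assume "p \<in> {..k}"
    then show "(\<Sum>xs\<in>lists_of (Suc k) N. g (take p xs) (xs ! p) (drop (Suc p) xs))
        = (n - of_nat k - 2) * square_sum k (\<lambda>xs. f (v # xs)) N a"
      by (subst sum_lists_of_insert_at)
         (auto simp: square_sum_def sum_distrib_left collapse intro!: sum.cong)
  qed simp
  \<comment> \<open>The collapsed value is the same for every position \<open>p\<close>, and there
    are \<open>Suc k\<close> positions.\<close>
  also have "\<dots> = (n - of_nat k - 2) * of_nat (Suc k) * square_sum k (\<lambda>xs. f (v # xs)) N a"
    by (simp only: sum_constant card_atMost ac_simps)
  finally show ?thesis
    unfolding n_def .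
qed

section \<open>Partitions of a set enlarged by one element\<close>

text \<open>The bijection behind the recursion for Stirling numbers of the second kind, for an
  arbitrary summand \<open>g\<close>: remove the part \<open>{x}\<close> if there is one, otherwise
  delete \<open>x\<close> from its part and remember that part.\<close>

lemma sum_partition_on_insert:
  fixes g :: "'i set set \<Rightarrow> 'b::comm_monoid_add"
  assumes fin: "finite N" and x: "x \<notin> N"
  shows "(\<Sum>P | partition_on (insert x N) P \<and> card P = Suc k. g P)
       = (\<Sum>P | partition_on N P \<and> card P = k. g (insert {x} P))
         + (\<Sum>P | partition_on N P \<and> card P = Suc k. \<Sum>I\<in>P. g (insert (insert x I) (P - {I})))"
proof -
  let ?A = "{P. partition_on (insert x N) P \<and> card P = Suc k}"
  have finA: "finite ?A"
    by (rule finite_subset[OF _ finitely_many_partition_on[of "insert x N"]]) (use fin in auto)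
  have fin_elems: "finite P" if "partition_on M P" "finite M" for M :: "'i set" and P
    using finite_elements that by blast
  have finB: "finite {P. partition_on N P \<and> card P = Suc k}"
    by (rule finite_subset[OF _ finitely_many_partition_on[OF fin]]) auto
  have part_x: "I = I'" if "partition_on M P" "I \<in> P" "I' \<in> P" "y \<in> I" "y \<in> I'"
    for M :: "'i set" and P I I' y
    using that by (auto simp: partition_on_def disjoint_def)
  have "(\<Sum>P\<in>?A \<inter> {P. {x} \<in> P}. g P) = (\<Sum>P | partition_on N P \<and> card P = k. g (insert {x} P))"
  proof (rule sum.reindex_bij_witness[where i = "insert {x}" and j = "\<lambda>P. P - {{x}}"])
    fix P assume P: "P \<in> ?A \<inter> {P. {x} \<in> P}"
    show "insert {x} (P - {{x}}) = P" using P by auto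
    then show "g (insert {x} (P - {{x}})) = g P" by simp
    have "partition_on N (P - {{x}})"
    proof (rule partition_onI)
      have "\<Union> (P - {{x}}) = \<Union> P - {x}"
        using part_x[of "insert x N" P "{x}" _ x] P by blast
      then show "\<Union> (P - {{x}}) = N"
        using P x by (auto simp: partition_on_def)
      show "disjnt p p'" if "p \<in> P - {{x}}" "p' \<in> P - {{x}}" "p \<noteq> p'" for p p'
        using that P by (auto simp: partition_on_def disjoint_def disjnt_def)
      show "{} \<notin> P - {{x}}" using P by (auto simp: partition_on_def)
    qed
    moreover have "card (P - {{x}}) = k"
      using P fin_elems[of "insert x N" P] fin by simp
    ultimately show "P - {{x}} \<in> {P. partition_on N P \<and> card P = k}" by simp
  next
    fix P assume P: "P \<in> {P. partition_on N P \<and> card P = k}"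
    then have nx: "{x} \<notin> P" and disj: "\<And>I. I \<in> P \<Longrightarrow> x \<notin> I"
      using x by (auto simp: partition_on_def)
    show "insert {x} P - {{x}} = P" using nx by auto
    have "partition_on (insert x N) (insert {x} P)"
      using P disj by (auto simp: partition_on_def disjoint_def)
    then show "insert {x} P \<in> ?A \<inter> {P. {x} \<in> P}"
      using P nx fin_elems[OF _ fin] by auto
  qed
  moreover have "(\<Sum>P\<in>?A - {P. {x} \<in> P}. g P)
    = (\<Sum>(P, I)\<in>(SIGMA P : {P. partition_on N P \<and> card P = Suc k}. P). g (insert (insert x I) (P - {I})))"
  proof (rule sum.reindex_bij_witness[where i = "\<lambda>(P, I). insert (insert x I) (P - {I})"
        and j = "\<lambda>P. let I = THE I. I \<in> P \<and> x \<in> I in (insert (I - {x}) (P - {I}), I - {x})"])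
    fix P assume P: "P \<in> ?A - {P. {x} \<in> P}"
    then have part: "partition_on (insert x N) P" by simp
    then obtain I where I: "I \<in> P" "x \<in> I" by (auto simp: partition_on_def)
    then have the: "(THE I. I \<in> P \<and> x \<in> I) = I"
      using part_x[OF part] by (intro the_equality) auto
    have "I \<noteq> {x}" using P I by auto
    then have ne: "I - {x} \<noteq> {}" using I by blast
    \<comment> \<open>Deleting \<open>x\<close> must not produce a part that is already present, or
      the number of parts would drop.\<close>
    have notin: "I - {x} \<notin> P"
      using part_x[OF part, of "I - {x}" I] ne I by blast
    have PI: "insert I (insert (I - {x}) (P - {I}) - {I - {x}}) = P"
      using notin I by auto
    then show "(\<lambda>(P, I). insert (insert x I) (P - {I}))
        (let I = THE I. I \<in> P \<and> x \<in> I in (insert (I - {x}) (P - {I}), I - {x})) = P"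
      using I by (simp add: the insert_absorb)
    show "(case let I = THE I. I \<in> P \<and> x \<in> I in (insert (I - {x}) (P - {I}), I - {x})
        of (P, I) \<Rightarrow> g (insert (insert x I) (P - {I}))) = g P"
      using I PI by (simp add: the insert_absorb)
    have "partition_on N (insert (I - {x}) (P - {I}))"
    proof (rule partition_onI)
      have "\<Union> (insert (I - {x}) (P - {I})) = \<Union> P - {x}"
        using I part_x[OF part, of _ I x] by blast
      then show "\<Union> (insert (I - {x}) (P - {I})) = N"
        using part x by (auto simp: partition_on_def)
      show "disjnt p p'" if "p \<in> insert (I - {x}) (P - {I})" "p' \<in> insert (I - {x}) (P - {I})"
        "p \<noteq> p'" for p p'
        using that I part unfolding partition_on_def disjoint_def disjnt_def by blast
      show "{} \<notin> insert (I - {x}) (P - {I})"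
        using ne part by (auto simp: partition_on_def)
    qed
    moreover have "card (insert (I - {x}) (P - {I})) = Suc k"
      using notin P I fin_elems[OF part] fin by simp
    ultimately show "(let I = THE I. I \<in> P \<and> x \<in> I in (insert (I - {x}) (P - {I}), I - {x}))
        \<in> (SIGMA P : {P. partition_on N P \<and> card P = Suc k}. P)"
      by (simp add: the)
  next
    fix q assume "q \<in> (SIGMA P : {P. partition_on N P \<and> card P = Suc k}. P)"
    then obtain P I where q: "q = (P, I)" and part: "partition_on N P" and card: "card P = Suc k"
      and I: "I \<in> P" by auto
    have nx: "x \<notin> J" if "J \<in> P" for J
      using that part x by (auto simp: partition_on_def)
    have ne: "I \<noteq> {}" using I part by (auto simp: partition_on_def)
    let ?Q = "insert (insert x I) (P - {I})"
    have the: "(THE J. J \<in> ?Q \<and> x \<in> J) = insert x I"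
      using nx by (intro the_equality) auto
    have notin: "insert x I \<notin> P" using nx by blast
    have "?Q - {insert x I} = P - {I}" "insert x I - {x} = I"
      using notin nx[OF I] by auto
    then show "(let J = THE J. J \<in> (\<lambda>(P, I). insert (insert x I) (P - {I})) q \<and> x \<in> J in
        (insert (J - {x}) ((\<lambda>(P, I). insert (insert x I) (P - {I})) q - {J}), J - {x})) = q"
      using I unfolding q prod.case the Let_def by auto
    have "partition_on (insert x N) ?Q"
    proof (rule partition_onI)
      show "\<Union> ?Q = insert x N" using part I by (auto simp: partition_on_def)
      show "disjnt p p'" if "p \<in> ?Q" "p' \<in> ?Q" "p \<noteq> p'" for p p'
        using that I part nx unfolding partition_on_def disjoint_def disjnt_def by blast
      show "{} \<notin> ?Q" using part by (auto simp: partition_on_def)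
    qed
    moreover have "card ?Q = Suc k"
      using notin I card fin_elems[OF part fin] by simp
    moreover have "{x} \<notin> ?Q"
      using ne nx[OF I] nx by auto
    ultimately show "(\<lambda>(P, I). insert (insert x I) (P - {I})) q \<in> ?A - {P. {x} \<in> P}"
      by (simp add: q)
  qed
  moreover have "\<dots> = (\<Sum>P | partition_on N P \<and> card P = Suc k. \<Sum>I\<in>P. g (insert (insert x I) (P - {I})))"
    using finB fin_elems[OF _ fin] by (subst sum.Sigma) auto
  ultimately show ?thesis
    using sum.Int_Diff[OF finA, of g "{P. {x} \<in> P}"] by simp
qed

section \<open>The partition identity for alternating forms\<close>

text \<open>\<open>square_sum_drop_one\<close> applies with \<open>v = b x\<close>. Adding
  \<open>x\<close> to \<open>X\<close> then contributes \<open>Suc k\<close> further copies of the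
  same value, hence the factor \<open>k + 2\<close>. This serves both for the new part
  \<open>{x}\<close> of a partition and for the maximal minors of a contraction.\<close>

lemma square_sum_codim_one:
  assumes "finite X" "card X = Suc k" "x \<notin> X" and f: "alternating (Suc k) f"
    and kill: "\<And>xs. length xs = k \<Longrightarrow> f (sum b (insert x X) # xs) = 0"
  shows "square_sum (Suc k) f X b = square_sum k (\<lambda>xs. f (b x # xs)) X b"
    and "square_sum (Suc k) f (insert x X) b
       = of_nat (k + 2) * square_sum k (\<lambda>xs. f (b x # xs)) X b"
proof -
  show eq: "square_sum (Suc k) f X b = square_sum k (\<lambda>xs. f (b x # xs)) X b"
    using kill assms(1-3) by (intro square_sum_drop_one[OF _ _ f]) (simp_all add: add.commute)
  show "square_sum (Suc k) f (insert x X) b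
      = of_nat (k + 2) * square_sum k (\<lambda>xs. f (b x # xs)) X b"
    unfolding square_sum_insert[OF assms(1,3) f] eq by (simp add: algebra_simps)
qed

text \<open>The number of permutations whose cycles are the parts of \<open>P\<close>.\<close>

definition cycle_weight :: "'i set set \<Rightarrow> 'b::{comm_semiring_1, semiring_char_0}" where
  "cycle_weight P = (\<Prod>I\<in>P. fact (card I - 1))"

lemma partition_on_card_1_iff:
  assumes "N \<noteq> {}"
  shows "partition_on N P \<and> card P = Suc 0 \<longleftrightarrow> P = {N}"
proof
  assume "partition_on N P \<and> card P = Suc 0"
  then show "P = {N}"
    by (auto simp: card_1_singleton_iff partition_on_def)
next
  assume "P = {N}"
  then show "partition_on N P \<and> card P = Suc 0"
    using assms by (simp add: partition_on_space)
qed

text \<open>The factor \<open>fact r\<close> on the left avoids division in the ring. All of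
  \<open>r\<close>, \<open>f\<close> and \<open>a\<close> vary in the induction: a new part
  \<open>{x}\<close> leads to \<open>fv\<close> with one argument less, a merged part to the
  modified columns \<open>a' j\<close>. For \<open>r = 0\<close> only the partition
  \<open>{N}\<close> occurs.\<close>

lemma square_sum_partition:
  fixes a :: "'i \<Rightarrow> 'v::ab_group_add"
    and f :: "'v list \<Rightarrow> 'b::{comm_ring_1, ring_char_0}"
  assumes "finite N" "N \<noteq> {}" "alternating r f"
    and "\<And>xs. Suc (length xs) = r \<Longrightarrow> f (sum a N # xs) = 0"
  shows "fact r * (\<Sum>P | partition_on N P \<and> card P = Suc r. cycle_weight P * square_sum r f P (sum a))
       = fact (card N - 1) * square_sum r f N a"
  using assms
proof (induction N arbitrary: r f a rule: finite_ne_induct)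
  case (singleton x)
  show ?case
  proof (cases r)
    case 0
    then show ?thesis
      by (simp add: partition_on_card_1_iff cycle_weight_def)
  next
    case (Suc k)
    \<comment> \<open>For \<open>r > 0\<close> both sides are zero: a single point has no partition
      into two or more parts, and its only column is the total, which \<open>f\<close>
      kills.\<close>
    have "{P. partition_on {x} P \<and> card P = Suc (Suc k)} = {}"
    proof (safe, goal_cases)
      case (1 P)
      have "I = {x}" if "I \<in> P" for I
        using 1 that Union_upper[OF that] by (auto simp: partition_on_def subset_singleton_iff)
      then have "P \<subseteq> {{x}}" by blast
      then have "card P \<le> card {{x}}" by (rule card_mono[rotated]) simp
      with 1 show ?case by simp
    qed
    moreover have "square_sum (Suc k) f {x} a = 0"
      unfolding square_sum_Suc unfolding square_sum_def
      using singleton.prems(2) Suc by simp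
    ultimately show ?thesis
      using Suc by (simp only: sum.empty) simp
  qed
next
  case (insert x N)
  note fin = \<open>finite N\<close> and x = \<open>x \<notin> N\<close>
  have f: "alternating r f" by fact
  define n where "n = card N"
  have n: "n > 0" using fin \<open>N \<noteq> {}\<close> by (simp add: n_def card_gt_0_iff)
  have card_insert: "card (insert x N) - 1 = n" using fin x by (simp add: n_def)
  have fin_elems: "finite P" if "partition_on N P" for P
    using finite_elements[OF fin that] .
  have elem: "I \<subseteq> N" "finite I" "x \<notin> I" "I \<noteq> {}" if "partition_on N P" "I \<in> P" for P I
  proof -
    show "I \<subseteq> N" using that by (auto simp: partition_on_def)
    then show "finite I" "x \<notin> I" using fin x finite_subset by auto
    show "I \<noteq> {}" using that by (auto simp: partition_on_def)
  qed
  show ?case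
  proof (cases r)
    case 0
    then show ?thesis
      using card_insert by (simp add: partition_on_card_1_iff cycle_weight_def)
  next
    case (Suc k)
    define v where "v = a x"
    define fv where "fv xs = f (v # xs)" for xs
    define a' where "a' j = a(j := a j + v)" for j
    have kill: "f ((sum a N + v) # xs) = 0" if "length xs = k" for xs
      using insert.prems(2)[of xs] that fin x Suc by (simp add: v_def add.commute)
    have alt: "alternating (Suc k) f" using f Suc by simp
    have altv: "alternating k fv"
      unfolding fv_def using alternating_Cons[OF alt] .
    \<comment> \<open>The columns of \<open>N\<close> sum to the killed total minus
      \<open>v\<close>, and the missing \<open>v\<close> does no harm because \<open>fv\<close>
      already has \<open>v\<close> as an argument.\<close>
    have killv: "fv (sum a N # xs) = 0" if "Suc (length xs) = k" for xs
    proof -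
      have "f (sum a N # v # xs) + f (v # v # xs) = 0"
        using kill[of "v # xs"] alternating_add[OF alt, of "[]" "v # xs" "sum a N" v] that by simp
      then show ?thesis
        unfolding fv_def
        using alternating_repeat[OF alt, of "[]" xs v]
          alternating_swap[OF alt, of "[]" xs v "sum a N"] that by simp
    qed
    let ?W = "cycle_weight :: 'i set set \<Rightarrow> 'b"
    let ?S = "\<lambda>P. ?W P * square_sum r f P (sum a)"

    \<comment> \<open>The \<open>Suc k\<close> parts of \<open>P\<close> and the part
      \<open>{x}\<close> carry \<open>k + 2\<close> vectors whose total is killed, so
      \<open>square_sum_codim_one\<close> applies; the new part has weight
      \<open>fact 0 = 1\<close>.\<close>
    have fixed: "?S (insert {x} P) = of_nat (k + 2) * (?W P * square_sum k fv P (sum a))"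
      if P: "partition_on N P" "card P = Suc k" for P
    proof -
      have "{x} \<notin> P" using elem(3)[OF P(1)] by blast
      moreover have "sum (sum a) (insert {x} P) = sum a (insert x N)"
      proof -
        have "sum (sum a) P = sum a (\<Union> P)"
          using P elem by (subst sum.Union_disjoint) (auto simp: partition_on_def disjoint_def)
        then show ?thesis
          using P \<open>{x} \<notin> P\<close> fin x fin_elems by (simp add: partition_on_def)
      qed
      ultimately have "square_sum r f (insert {x} P) (sum a)
          = of_nat (k + 2) * square_sum k fv P (sum a)"
        unfolding Suc fv_def v_def
        using square_sum_codim_one(2)[OF fin_elems[OF P(1)] P(2) _ alt, of "{x}" "sum a"]
          insert.prems(2) Suc by simp
      moreover have "?W (insert {x} P) = ?W P"
        using \<open>{x} \<notin> P\<close> fin_elems[OF P(1)] by (simp add: cycle_weight_def)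
      ultimately show ?thesis by simp
    qed

    have merged: "?S (insert (insert x I) (P - {I}))
        = (\<Sum>j\<in>I. ?W P * square_sum r f P (sum (a' j)))"
      if P: "partition_on N P" "I \<in> P" for P I
    proof -
      let ?\<phi> = "\<lambda>K. if K = I then insert x I else K"
      have image: "insert (insert x I) (P - {I}) = ?\<phi> ` P"
        using P by auto
      have inj: "inj_on ?\<phi> P"
        using elem(3)[OF P(1)] by (auto simp: inj_on_def)
      \<comment> \<open>Adding \<open>v\<close> to one column \<open>a j\<close> with
        \<open>j\<close> in \<open>I\<close> changes only the sum over \<open>I\<close>, and in the
        same way for every such \<open>j\<close>.\<close>
      have sq: "square_sum r f (insert (insert x I) (P - {I})) (sum a)
          = square_sum r f P (sum (a' j))" if "j \<in> I" for j
      proof -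
        have eq: "sum a (?\<phi> K) = sum (a' j) K" if "K \<in> P" for K
        proof (cases "K = I")
          case True
          then show ?thesis
            using \<open>j \<in> I\<close> elem[OF P]
            by (simp add: a'_def v_def sum.remove[of I j] add.commute add.left_commute)
        next
          case False
          then have "j \<notin> K"
            using P \<open>K \<in> P\<close> \<open>j \<in> I\<close> by (auto simp: partition_on_def disjoint_def)
          then have "sum a K = sum (a' j) K" by (intro sum.cong) (auto simp: a'_def)
          then show ?thesis using False by simp
        qed
        have map_eq: "map (sum a \<circ> ?\<phi>) xs = map (sum (a' j)) xs" if "set xs \<subseteq> P" for xs
          using that by (intro map_cong refl) (unfold o_apply, blast intro: eq)
        show ?thesis
          unfolding image square_sum_reindex[OF inj] by (rule square_sum_cong) (simp only: map_eq)
      qed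
      have "insert x I \<notin> P - {I}" using elem(3)[OF P(1)] by blast
      then have "?W (insert (insert x I) (P - {I})) = fact (card I) * (\<Prod>K\<in>P - {I}. fact (card K - 1))"
        using fin_elems[OF P(1)] elem[OF P] by (simp add: cycle_weight_def)
      also have "fact (card I) = (of_nat (card I) :: 'b) * fact (card I - 1)"
        using elem[OF P] by (simp add: fact_reduce card_gt_0_iff)
      also have "of_nat (card I) * fact (card I - 1) * (\<Prod>K\<in>P - {I}. fact (card K - 1))
          = of_nat (card I) * ?W P"
        unfolding cycle_weight_def prod.remove[OF fin_elems[OF P(1)] P(2)] by (simp add: mult.assoc)
      finally have w: "?W (insert (insert x I) (P - {I})) = of_nat (card I) * ?W P" .
      have "(\<Sum>j\<in>I. ?W P * square_sum r f P (sum (a' j)))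
          = (\<Sum>j\<in>I. ?W P * square_sum r f (insert (insert x I) (P - {I})) (sum a))"
        by (rule sum.cong) (simp_all only: sq)
      then show ?thesis by (simp add: w mult.assoc)
    qed

    \<comment> \<open>Choosing a part and then an index in it amounts to choosing an index of
      \<open>N\<close>. This choice no longer depends on \<open>P\<close>, so the sums can be
      exchanged and the induction hypothesis used for each \<open>j\<close>.\<close>
    have merged_sum: "(\<Sum>I\<in>P. ?S (insert (insert x I) (P - {I})))
        = (\<Sum>j\<in>N. ?W P * square_sum r f P (sum (a' j)))" if P: "partition_on N P" for P
    proof -
      have "(\<Sum>I\<in>P. ?S (insert (insert x I) (P - {I})))
          = (\<Sum>I\<in>P. \<Sum>j\<in>I. ?W P * square_sum r f P (sum (a' j)))"
        by (rule sum.cong) (simp_all only: merged[OF P])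
      also have "\<dots> = (\<Sum>j\<in>\<Union> P. ?W P * square_sum r f P (sum (a' j)))"
        using P elem by (subst sum.Union_disjoint) (auto simp: partition_on_def disjoint_def)
      finally show ?thesis using P by (simp add: partition_on_def)
    qed

    have IHv: "fact k * (\<Sum>P | partition_on N P \<and> card P = Suc k. ?W P * square_sum k fv P (sum a))
        = fact (n - 1) * square_sum k fv N a"
      unfolding n_def by (rule insert.IH[OF altv killv])
    have IHj: "fact r * (\<Sum>P | partition_on N P \<and> card P = Suc r. ?W P * square_sum r f P (sum (a' j)))
        = fact (n - 1) * square_sum r f N (a' j)" if "j \<in> N" for j
      unfolding n_def
    proof (rule insert.IH[OF f])
      fix xs :: "'v list" assume "Suc (length xs) = r"
      \<comment> \<open>For every \<open>j\<close> the modified columns have the old total over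
        \<open>insert x N\<close>, which \<open>f\<close> kills.\<close>
      moreover have "sum (a' j) N = sum a N + v"
        using fin that by (simp add: a'_def sum.remove[of N j] add.commute add.left_commute)
      ultimately show "f (sum (a' j) N # xs) = 0" using kill Suc by simp
    qed

    have "fact r * (\<Sum>P | partition_on (insert x N) P \<and> card P = Suc r. ?S P)
        = fact r * (\<Sum>P | partition_on N P \<and> card P = r. ?S (insert {x} P))
          + fact r * (\<Sum>P | partition_on N P \<and> card P = Suc r. \<Sum>I\<in>P. ?S (insert (insert x I) (P - {I})))"
      unfolding sum_partition_on_insert[OF fin x] distrib_left ..
    also have "(\<Sum>P | partition_on N P \<and> card P = r. ?S (insert {x} P))
        = of_nat (k + 2) * (\<Sum>P | partition_on N P \<and> card P = Suc k. ?W P * square_sum k fv P (sum a))"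
      unfolding sum_distrib_left by (rule sum.cong) (use Suc fixed in auto)
    also have "fact r * \<dots> = of_nat (Suc k) * of_nat (k + 2) *
        (fact k * (\<Sum>P | partition_on N P \<and> card P = Suc k. ?W P * square_sum k fv P (sum a)))"
      unfolding Suc fact_Suc by (simp only: ac_simps)
    also have "\<dots> = of_nat (Suc k) * of_nat (k + 2) * (fact (n - 1) * square_sum k fv N a)"
      unfolding IHv ..
    also have "fact r * (\<Sum>P | partition_on N P \<and> card P = Suc r. \<Sum>I\<in>P. ?S (insert (insert x I) (P - {I})))
        = fact r * (\<Sum>P | partition_on N P \<and> card P = Suc r. \<Sum>j\<in>N. ?W P * square_sum r f P (sum (a' j)))"
      by (simp add: merged_sum)
    also have "\<dots> = (\<Sum>j\<in>N. fact r * (\<Sum>P | partition_on N P \<and> card P = Suc r. ?W P * square_sum r f P (sum (a' j))))"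
      unfolding sum_distrib_left by (rule sum.swap)
    also have "\<dots> = (\<Sum>j\<in>N. fact (n - 1) * square_sum r f N (a' j))"
      by (rule sum.cong) (simp_all only: IHj)
    also have "\<dots> = fact (n - 1) * (\<Sum>j\<in>N. square_sum r f N (a' j))"
      by (rule sum_distrib_left[symmetric])
    also have "(\<Sum>j\<in>N. square_sum r f N (a' j)) = of_nat n * square_sum r f N a
        + (of_nat n - of_nat k - 2) * of_nat (Suc k) * square_sum k fv N a"
      unfolding a'_def n_def Suc fv_def using square_sum_shift[OF fin alt kill] .
    \<comment> \<open>The coefficients of \<open>square_sum k fv N a\<close> add up as
      \<open>(k + 1) * (k + 2) + (n - k - 2) * (k + 1) = n * (k + 1)\<close>, just what
      \<open>square_sum_insert\<close> asks for.\<close>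
    also have "of_nat (Suc k) * of_nat (k + 2) * (fact (n - 1) * square_sum k fv N a)
        + fact (n - 1) * (of_nat n * square_sum r f N a
        + (of_nat n - of_nat k - 2) * of_nat (Suc k) * square_sum k fv N a)
        = of_nat n * fact (n - 1) * (square_sum r f N a + of_nat (Suc k) * square_sum k fv N a)"
      by (simp add: algebra_simps)
    also have "of_nat n * fact (n - 1) = (fact n :: 'b)"
      using n by (simp add: fact_reduce)
    also have "square_sum r f N a + of_nat (Suc k) * square_sum k fv N a
        = square_sum r f (insert x N) a"
      unfolding Suc fv_def v_def using square_sum_insert[OF fin x alt] by simp
    finally show ?thesis unfolding card_insert .
  qed
qed

section \<open>Determinants of columns and minors of a matrix\<close>

text \<open>Indices are inserted in decreasing order, so the new one heads every sorted list that
  contains it, as in \<open>square_sum_insert\<close>; the factors \<open>Suc k\<close> accumulate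
  to the factorial.\<close>

lemma square_sum_sorted:
  fixes X :: "'i::linorder set" and f :: "'v::ab_group_add list \<Rightarrow> 'b::{comm_ring_1, ring_char_0}"
  assumes "finite X" "alternating r f"
  shows "square_sum r f X b
       = fact r * (\<Sum>J | J \<subseteq> X \<and> card J = r. (f (map b (sorted_list_of_set J)))\<^sup>2)"
  using assms
proof (induction X arbitrary: r f rule: finite_linorder_min_induct)
  case empty
  show ?case
  proof (cases r)
    case 0
    then have "{J. J \<subseteq> ({} :: 'i set) \<and> card J = r} = {{}}" by auto
    then show ?thesis using 0 by simp
  next
    case (Suc k)
    then have "{J. J \<subseteq> ({} :: 'i set) \<and> card J = r} = {}" by auto
    then show ?thesis using Suc by (simp only: square_sum_Suc sum.empty) simp
  qed
next
  case (insert x X)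
  have x: "x \<notin> X" using insert.hyps by blast
  show ?case
  proof (cases r)
    case 0
    have "{J. J \<subseteq> insert x X \<and> card J = 0} = {{}}"
      using insert.hyps by (auto dest: finite_subset)
    then show ?thesis using 0 by simp
  next
    case (Suc k)
    have alt: "alternating (Suc k) f" using insert.prems Suc by simp
    let ?m = "\<lambda>J. (f (map b (sorted_list_of_set J)))\<^sup>2"
    have fin: "finite J" if "J \<subseteq> X" for J
      using that insert.hyps finite_subset by blast
    have split: "{J. J \<subseteq> insert x X \<and> card J = Suc k}
        = {J. J \<subseteq> X \<and> card J = Suc k} \<union> insert x ` {J. J \<subseteq> X \<and> card J = k}"
    proof (intro equalityI subsetI)
      fix J assume J: "J \<in> {J. J \<subseteq> insert x X \<and> card J = Suc k}"
      show "J \<in> {J. J \<subseteq> X \<and> card J = Suc k} \<union> insert x ` {J. J \<subseteq> X \<and> card J = k}"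
      proof (cases "x \<in> J")
        case True
        then have "J = insert x (J - {x})" "J - {x} \<subseteq> X" "card (J - {x}) = k"
          using J by auto
        then show ?thesis by blast
      qed (use J in auto)
    qed (use x fin in \<open>auto simp: card_insert_if\<close>)
    have cons: "sorted_list_of_set (insert x J) = x # sorted_list_of_set J" if "J \<subseteq> X" for J
      using that insert.hyps fin[OF that] x
      by (subst sorted_list_of_set_insert) (auto intro!: insort_is_Cons less_imp_le)
    have "(\<Sum>J | J \<subseteq> insert x X \<and> card J = Suc k. ?m J)
        = (\<Sum>J | J \<subseteq> X \<and> card J = Suc k. ?m J) + (\<Sum>J\<in>insert x ` {J. J \<subseteq> X \<and> card J = k}. ?m J)"
      unfolding split using insert.hyps x by (intro sum.union_disjoint) auto
    also have "(\<Sum>J\<in>insert x ` {J. J \<subseteq> X \<and> card J = k}. ?m J)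
        = (\<Sum>J | J \<subseteq> X \<and> card J = k. (f (b x # map b (sorted_list_of_set J)))\<^sup>2)"
      using x by (subst sum.reindex) (auto simp: inj_on_def cons insert_ident intro!: sum.cong)
    finally show ?thesis
      unfolding Suc
      by (simp add: square_sum_insert[OF \<open>finite X\<close> x alt] insert.IH[OF alt]
          insert.IH[OF alternating_Cons[OF alt]] algebra_simps)
  qed
qed

text \<open>Columns are functions on all of \<open>nat\<close>; only their values below \<open>r\<close> matter.\<close>

definition column_det :: "nat \<Rightarrow> (nat \<Rightarrow> 'a::comm_ring_1) list \<Rightarrow> 'a" where
  "column_det r xs = det (mat r r (\<lambda>(i, j). (xs ! j) i))"

lemma column_det_eq:
  "column_det r xs = (\<Sum>p | p permutes {0..<r}. signof p * (\<Prod>j<r. (xs ! j) (p j)))"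
proof -
  have "column_det r xs = (\<Sum>p | p permutes {0..<r}.
      signof p * (\<Prod>j<r. mat r r (\<lambda>(i, j). (xs ! j) i) $$ (p j, j)))"
    unfolding column_det_def by (rule det_col) simp
  also have "\<dots> = (\<Sum>p | p permutes {0..<r}. signof p * (\<Prod>j<r. (xs ! j) (p j)))"
  proof (intro sum.cong arg_cong[of _ _ "(*) _"] prod.cong refl)
    fix p j assume "p \<in> {p. p permutes {0..<r}}" "j \<in> {..<r}"
    then show "mat r r (\<lambda>(i, j). (xs ! j) i) $$ (p j, j) = (xs ! j) (p j)"
      using permutes_in_image[of p "{0..<r}" j] by simp
  qed
  finally show ?thesis .
qed

lemma column_det_cong:
  assumes "\<And>i j. i < r \<Longrightarrow> j < r \<Longrightarrow> (xs ! j) i = (ys ! j) i"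
  shows "column_det r xs = column_det r ys"
  unfolding column_det_def using assms by (intro arg_cong[of _ _ det] cong_mat) auto

lemma alternating_column_det: "alternating r (column_det r)"
  unfolding alternating_def
proof (intro conjI allI impI)
  fix xs ys :: "(nat \<Rightarrow> 'a) list" and x y :: "nat \<Rightarrow> 'a"
  assume len: "Suc (length xs + length ys) = r"
  let ?k = "length xs"
  \<comment> \<open>Only the factor at position \<open>?k\<close> involves \<open>z\<close>; the
    placeholder \<open>0\<close> shows that the others are independent of it.\<close>
  have split: "(\<Prod>j<r. ((xs @ z # ys) ! j) (p j))
      = z (p ?k) * (\<Prod>j\<in>{..<r} - {?k}. ((xs @ 0 # ys) ! j) (p j))" for z p
  proof -
    have "(\<Prod>j<r. ((xs @ z # ys) ! j) (p j))
        = ((xs @ z # ys) ! ?k) (p ?k) * (\<Prod>j\<in>{..<r} - {?k}. ((xs @ z # ys) ! j) (p j))"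
      using len by (intro prod.remove) auto
    also have "(\<Prod>j\<in>{..<r} - {?k}. ((xs @ z # ys) ! j) (p j))
        = (\<Prod>j\<in>{..<r} - {?k}. ((xs @ 0 # ys) ! j) (p j))"
      by (rule prod.cong) (auto simp: nth_append nth_Cons split: nat.split)
    finally show ?thesis by simp
  qed
  show "column_det r (xs @ (x + y) # ys)
      = column_det r (xs @ x # ys) + column_det r (xs @ y # ys)"
    unfolding column_det_eq split by (simp add: plus_fun_def sum.distrib algebra_simps)
next
  fix xs ys :: "(nat \<Rightarrow> 'a) list" and x :: "nat \<Rightarrow> 'a"
  assume len: "Suc (Suc (length xs + length ys)) = r"
  let ?k = "length xs" and ?M = "mat r r (\<lambda>(i, j). ((xs @ x # x # ys) ! j) i)"
  have "col ?M ?k = col ?M (Suc ?k)"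
    using len by (intro eq_vecI) (simp_all add: nth_append)
  then show "column_det r (xs @ x # x # ys) = 0"
    unfolding column_det_def
    using len by (intro det_identical_columns[of _ r ?k "Suc ?k"]) auto
qed

text \<open>Needed because column functions taken from a matrix are unspecified from row
  \<open>r\<close> on, so their total is zero only below \<open>r\<close>, not as a
  function.\<close>

lemma column_det_zero:
  assumes "Suc (length xs) = r" "\<And>i. i < r \<Longrightarrow> x i = 0"
  shows "column_det r (x # xs) = 0"
proof -
  have "column_det r (x # xs) = column_det r (0 # xs)"
    using assms(2) by (intro column_det_cong) (auto simp: nth_Cons split: nat.split)
  moreover have "column_det r ([] @ (0 + 0) # xs) = column_det r ([] @ 0 # xs) + column_det r ([] @ 0 # xs)"
    using assms(1) by (intro alternating_add[OF alternating_column_det]) simp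
  ultimately show ?thesis by simp
qed

text \<open>Links \<open>pick\<close>, by which \<open>submatrix\<close> selects columns, to the
  sorted lists of \<open>square_sum_sorted\<close>.\<close>

lemma sorted_list_of_set_eq_map_pick:
  assumes "finite J"
  shows "sorted_list_of_set J = map (pick J) [0..<card J]"
proof (rule strict_sorted_equal)
  show "sorted_wrt (<) (map (pick J) [0..<card J])"
    by (auto simp: sorted_wrt_iff_nth_less pick_mono_le)
  have inj: "inj_on (pick J) {0..<card J}"
    by (rule linorder_inj_onI) (use pick_mono_le[of _ J] in force)+
  have "pick J ` {0..<card J} = J"
  proof (rule card_subset_eq[OF assms])
    show "pick J ` {0..<card J} \<subseteq> J" using pick_in_set_le by auto
    show "card (pick J ` {0..<card J}) = card J" using inj by (simp add: card_image)
  qed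
  then show "set (sorted_list_of_set J) = set (map (pick J) [0..<card J])"
    using assms by simp
qed simp

lemma column_minor_eq:
  assumes M: "M \<in> carrier_mat r m"
    and b: "\<And>i j. i < r \<Longrightarrow> j < m \<Longrightarrow> M $$ (i, j) = b j i"
    and J: "J \<subseteq> {..<m}" "card J = r"
  shows "column_minor M J = column_det r (map b (sorted_list_of_set J))"
proof -
  have fin: "finite J" using J(1) finite_subset by blast
  have "{j. j < dim_col M \<and> j \<in> J} = J" using M J by auto
  then have "submatrix M UNIV J
      = mat r r (\<lambda>(i, j). (map b (sorted_list_of_set J) ! j) i)"
    using M J b pick_in_set_le[of _ J]
    by (auto simp: submatrix_def sorted_list_of_set_eq_map_pick[OF fin] pick_UNIV subset_iff
        intro!: eq_matI)
  then show ?thesis by (simp add: column_minor_def column_det_def)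
qed

lemma column_minor_sum_squares:
  fixes b :: "nat \<Rightarrow> nat \<Rightarrow> 'a::{comm_ring_1, ring_char_0}"
  assumes M: "M \<in> carrier_mat r m"
    and b: "\<And>i j. i < r \<Longrightarrow> j < m \<Longrightarrow> M $$ (i, j) = b j i"
  shows "square_sum r (column_det r) {..<m} b
       = fact r * (\<Sum>J | J \<subseteq> {..<m} \<and> card J = r. (column_minor M J)\<^sup>2)"
  by (simp add: square_sum_sorted[OF _ alternating_column_det] column_minor_eq[OF assms])

section \<open>The gcd of the maximal minors\<close>

text \<open>With exactly \<open>r\<close> rows, the only choice of \<open>r\<close> rows is all of
  them.\<close>

lemma gcd_minors_eq:
  assumes "M \<in> carrier_mat r m"
  shows "gcd_minors r M = Gcd {column_minor M J | J. J \<subseteq> {..<m} \<and> card J = r}"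
proof -
  have sub: "submatrix M I J = submatrix M UNIV J" if "I \<subseteq> {..<r}" "card I = r" for I J
  proof -
    have "I = {..<r}" using that by (simp add: card_subset_eq)
    moreover have "pick {..<r} i = i" if "i < r" for i
      using pick_card_in_set[of i "{..<r}"] that
      by (simp add: Collect_conj_eq lessThan_def[symmetric] Int_absorb1)
    ultimately show ?thesis
      using assms by (intro eq_matI) (auto simp: submatrix_def pick_UNIV)
  qed
  have "{det (submatrix M I J) | I J. I \<subseteq> {..<r} \<and> card I = r \<and> J \<subseteq> {..<m} \<and> card J = r}
      = {column_minor M J | J. J \<subseteq> {..<m} \<and> card J = r}" (is "?L = ?R")
  proof (intro equalityI subsetI)
    fix d assume "d \<in> ?L"
    then obtain I J where "d = det (submatrix M I J)" "I \<subseteq> {..<r}" "card I = r"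
        "J \<subseteq> {..<m}" "card J = r" by blast
    then have "d = column_minor M J" by (simp add: column_minor_def sub)
    with \<open>J \<subseteq> {..<m}\<close> \<open>card J = r\<close> show "d \<in> ?R" by blast
  next
    fix d assume "d \<in> ?R"
    then obtain J where J: "d = column_minor M J" "J \<subseteq> {..<m}" "card J = r" by blast
    then have "d = det (submatrix M {..<r} J)" by (simp add: column_minor_def sub)
    moreover have "{..<r} \<subseteq> {..<r}" "card {..<r} = r" by simp_all
    ultimately show "d \<in> ?L" using J(2,3) by (intro CollectI exI conjI)
  qed
  then show ?thesis
    using assms by (simp add: gcd_minors_def)
qed

text \<open>The fact \<open>minor\<close> expresses one and the same sum through any single
  \<open>J\<close>. So all maximal minors share one absolute value, and this is their gcd.\<close>

lemma gcd_minors_square_sum: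
  fixes M :: "int mat"
  assumes M: "M \<in> carrier_mat r (Suc r)" and "r \<ge> 1"
    and b: "\<And>i j. i < r \<Longrightarrow> j < Suc r \<Longrightarrow> M $$ (i, j) = b j i"
    and zero: "\<And>i. i < r \<Longrightarrow> sum b {..<Suc r} i = 0"
  shows "square_sum r (column_det r) {..<Suc r} b = fact (Suc r) * (gcd_minors r M)\<^sup>2"
proof -
  let ?T = "square_sum r (column_det r)"
  obtain k where k: "r = Suc k" using \<open>r \<ge> 1\<close> by (cases r) auto
  have minor: "?T {..<Suc r} b = fact (Suc r) * (column_minor M J)\<^sup>2"
    if J: "J \<subseteq> {..<Suc r}" "card J = r" for J
  proof -
    have fin: "finite J" using J(1) finite_subset by blast
    have "card ({..<Suc r} - J) = 1"
      using J fin by (simp add: card_Diff_subset)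
    then obtain x where "{..<Suc r} - J = {x}"
      using card_1_singletonE by blast
    then have x: "x \<notin> J" "insert x J = {..<Suc r}" using J by auto
    have kill: "column_det (Suc k) (sum b (insert x J) # xs) = 0" if "length xs = k" for xs
      unfolding x using that zero k by (intro column_det_zero) auto
    \<comment> \<open>The two equations of \<open>square_sum_codim_one\<close> combine, with
      \<open>k + 2 = Suc r\<close>, where \<open>x\<close> is the one column outside
      \<open>J\<close>.\<close>
    have "?T {..<Suc r} b = of_nat (Suc r) * ?T J b"
      unfolding x(2)[symmetric]
      using square_sum_codim_one[OF fin J(2)[unfolded k] x(1) alternating_column_det kill]
      by (simp add: k)
    also have "?T J b = fact r * (column_minor M J)\<^sup>2"
    proof -
      have "K = J" if "K \<subseteq> J" "card K = r" for K
        using card_subset_eq[OF fin that(1)] that J by simp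
      then have "{K. K \<subseteq> J \<and> card K = r} = {J}" using J by auto
      then show ?thesis
        by (simp add: square_sum_sorted[OF fin alternating_column_det] column_minor_eq[OF M b J])
    qed
    finally show ?thesis by (simp add: algebra_simps)
  qed
  define m where "m = \<bar>column_minor M {..<r}\<bar>"
  have abs_minor: "\<bar>column_minor M J\<bar> = m" if J: "J \<subseteq> {..<Suc r}" "card J = r" for J
  proof -
    have "fact (Suc r) * (column_minor M J)\<^sup>2 = fact (Suc r) * (column_minor M {..<r})\<^sup>2"
      using minor[OF J] minor[of "{..<r}"] by simp
    then show ?thesis by (simp add: m_def abs_eq_iff power2_eq_iff del: fact_Suc)
  qed
  let ?S = "{column_minor M J | J. J \<subseteq> {..<Suc r} \<and> card J = r}"
  have "Gcd ?S = m"
  proof (rule zdvd_antisym_nonneg)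
    have "column_minor M {..<r} \<in> ?S" by fastforce
    then show "Gcd ?S dvd m" unfolding m_def dvd_abs_iff by (rule Gcd_dvd)
    show "m dvd Gcd ?S"
    proof (rule Gcd_greatest)
      fix d assume "d \<in> ?S"
      then have "\<bar>d\<bar> = m" using abs_minor by blast
      then show "m dvd d" by auto
    qed
  qed (simp_all add: m_def)
  then have "gcd_minors r M = m"
    unfolding gcd_minors_eq[OF M] .
  then show ?thesis
    using minor[of "{..<r}"] by (simp add: m_def)
qed

section \<open>The identity for integer matrices with zero row sums\<close>

theorem proposition2p10:
  fixes r n :: nat and A :: "int mat"
  assumes "r \<ge> 1" and "n \<ge> r + 1"
    and "A \<in> carrier_mat r n"
    and "\<forall>i<r. (\<Sum>j<n. A $$ (i, j)) = 0"
  shows "(- 1) ^ (n + r) / 12 *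
      (\<Sum>P | partition_on {..<n} P \<and> card P = r + 1.
         (\<Prod>I\<in>P. fact (card I - 1)) * (of_int (gcd_minors r (contraction A P)))\<^sup>2)
    = ((- 1) ^ (n + r) / 12 * (fact (n - 1) / fact (r + 1)) *
      (\<Sum>J | J \<subseteq> {..<n} \<and> card J = r. (of_int (column_minor A J))\<^sup>2) :: rat)"
proof -
  define a where "a j i = A $$ (i, j)" for j i
  let ?T = "square_sum r (column_det r)"
  have sum_apply: "sum g X i = (\<Sum>j\<in>X. g j i)" for g :: "nat \<Rightarrow> nat \<Rightarrow> int" and X i
    by (induction X rule: infinite_finite_induct) simp_all
  have parts: "?T P (sum a) = fact (Suc r) * (gcd_minors r (contraction A P))\<^sup>2"
    if P: "partition_on {..<n} P" "card P = Suc r" for P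
  proof -
    note pl = parts_list[OF P(1)]
    let ?b = "sum a \<circ> (!) (parts_list P)"
    \<comment> \<open>\<open>square_sum\<close> does not depend on an order of the parts, so it can
      be reindexed along the order that \<open>contraction\<close> uses.\<close>
    have bij: "bij_betw ((!) (parts_list P)) {..<Suc r} P"
      using bij_betw_nth[OF pl(2), of "{..<Suc r}" P] pl P by simp
    then have "?T P (sum a) = ?T {..<Suc r} ?b"
      using square_sum_reindex[of "(!) (parts_list P)" "{..<Suc r}" r "column_det r" "sum a"]
      by (simp add: bij_betw_def)
    also have "\<dots> = fact (Suc r) * (gcd_minors r (contraction A P))\<^sup>2"
    proof (rule gcd_minors_square_sum)
      show "contraction A P \<in> carrier_mat r (Suc r)"
        using assms(3) P by (simp add: contraction_def)
      show "contraction A P $$ (i, j) = ?b j i" if "i < r" "j < Suc r" for i j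
        using assms(3) P that by (simp add: contraction_def sum_apply a_def)
      have "sum ?b {..<Suc r} = sum (sum a) P"
        using sum.reindex_bij_betw[OF bij, of "sum a"] by simp
      also have "\<dots> = sum a (\<Union> P)"
      proof (subst sum.Union_disjoint)
        show "\<forall>I\<in>P. finite I"
          using P(1) by (auto simp: partition_on_def intro: finite_subset[of _ "{..<n}"])
      qed (use P(1) in \<open>auto simp: partition_on_def disjoint_def\<close>)
      finally have "sum ?b {..<Suc r} = sum a {..<n}"
        using P(1) by (simp add: partition_on_def)
      then show "sum ?b {..<Suc r} i = 0" if "i < r" for i
        using assms(4) that by (simp add: sum_apply a_def)
    qed fact
    finally show ?thesis .
  qed
  have "fact r * (\<Sum>P | partition_on {..<n} P \<and> card P = Suc r. cycle_weight P * ?T P (sum a))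
      = fact (card {..<n} - 1) * ?T {..<n} a"
  proof (rule square_sum_partition)
    show "{..<n} \<noteq> {}" using assms(2) by (auto simp: lessThan_empty_iff)
    show "column_det r (sum a {..<n} # xs) = 0" if "Suc (length xs) = r" for xs
      using that assms(4) by (intro column_det_zero) (simp_all add: sum_apply a_def)
  qed (simp_all add: alternating_column_det)
  also have "?T {..<n} a = fact r * (\<Sum>J | J \<subseteq> {..<n} \<and> card J = r. (column_minor A J)\<^sup>2)"
    using assms(3) by (intro column_minor_sum_squares) (simp_all add: a_def)
  also have "(\<Sum>P | partition_on {..<n} P \<and> card P = Suc r. cycle_weight P * ?T P (sum a))
      = fact (Suc r) * (\<Sum>P | partition_on {..<n} P \<and> card P = Suc r.
          cycle_weight P * (gcd_minors r (contraction A P))\<^sup>2)"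
    unfolding sum_distrib_left by (rule sum.cong) (auto simp: parts)
  \<comment> \<open>The left \<open>fact r\<close> comes from \<open>square_sum_partition\<close>,
    the right one from passing from tuples to subsets; they cancel.\<close>
  finally have "fact r * (fact (Suc r) * (\<Sum>P | partition_on {..<n} P \<and> card P = Suc r.
          cycle_weight P * (gcd_minors r (contraction A P))\<^sup>2))
      = fact r * (fact (n - 1) * (\<Sum>J | J \<subseteq> {..<n} \<and> card J = r. (column_minor A J)\<^sup>2))"
    by (simp only: card_lessThan ac_simps)
  then have "fact (Suc r) * (\<Sum>P | partition_on {..<n} P \<and> card P = Suc r.
          cycle_weight P * (gcd_minors r (contraction A P))\<^sup>2)
      = fact (n - 1) * (\<Sum>J | J \<subseteq> {..<n} \<and> card J = r. (column_minor A J)\<^sup>2)"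
    by (simp del: fact_Suc)
  \<comment> \<open>Everything so far holds over the integers; rationals enter only for the quotient
    of factorials and the constant 1/12.\<close>
  then have "of_int (fact (Suc r) * (\<Sum>P | partition_on {..<n} P \<and> card P = Suc r.
          cycle_weight P * (gcd_minors r (contraction A P))\<^sup>2))
      = (of_int (fact (n - 1) * (\<Sum>J | J \<subseteq> {..<n} \<and> card J = r. (column_minor A J)\<^sup>2)) :: rat)"
    by (simp only:)
  then have "fact (Suc r) * (\<Sum>P | partition_on {..<n} P \<and> card P = Suc r.
          (\<Prod>I\<in>P. fact (card I - 1)) * (of_int (gcd_minors r (contraction A P)))\<^sup>2)
      = fact (n - 1) * (\<Sum>J | J \<subseteq> {..<n} \<and> card J = r. (of_int (column_minor A J))\<^sup>2 :: rat)"
    by (simp add: cycle_weight_def del: fact_Suc)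
  then show ?thesis
    by (simp add: field_simps del: fact_Suc)
qed

end
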